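(* For every integer $d\ge1$ and every $t>0$ there exist constants $C_4(d,t),C_5(d,t)>0$ depending only on $d$ and $t$ such that the following holds. Let $N\ge2$ be an integer and let $f$ be a real-valued function, not identically zero, which is $1$-periodic in each variable and belongs to $C^2([0,1]^d)$. Let $H_tf=e^{t\Delta}f$ be the periodic heat snapshot of $f$ at time $t$ and let $g_t(x)=(H_tf)(x/N)$, $x\in\mathbb{Z}_N^d$, be its discretization on $\mathbb{Z}_N^d$. Assume that $$N\|H_tf\|_{L^2([0,1]^d)}^2\ge 4C_d\|H_tf\|_{C^2([0,1]^d)}^2 .$$ Define $$A_t^{\mathrm{heat}}=2\,\frac{\left|\int_{[0,1]^d}(H_tf)(x)\,dx\right|}{\|H_tf\|_{L^2([0,1]^d)}},\quad B_t^{\mathrm{heat}}=C_4(d,t)\frac{\|f\|_{C^2([0,1]^d)}}{\|H_tf\|_{L^2([0,1]^d)}},\quad C_{N,t}^{\mathrm{heat}}=C_5(d,t)\frac{\|f\|_{C^2([0,1]^d)}}{\|H_tf\|_{L^2([0,1]^d)}}\,\frac1N,$$ and $r_{N,t}^{\mathrm{heat}}=A_t^{\mathrm{heat}}+B_t^{\mathrm{heat}}+C_{N,t}^{\mathrm{heat}}$. Then $$FR(g_t)\le r_{N,t}^{\mathrm{heat}} .$$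
   Context: $\mathbb{Z}_N=\mathbb{Z}/N\mathbb{Z}$. A function that is $1$-periodic in each variable and belongs to $C^k([0,1]^d)$ means a function on $\mathbb{R}^d$ that is $1$-periodic in each variable and of class $C^k$, and $\|F\|_{C^k([0,1]^d)}=\sum_{|\alpha|\le k}\sup_{[0,1]^d}|\partial^\alpha F|$. For $f$ with Fourier coefficients $a_k=\int_{[0,1]^d}f(x)e^{-2\pi ik\cdot x}dx$, $k\in\mathbb{Z}^d$, and $t>0$, the periodic heat snapshot is $H_tf(x)=e^{t\Delta}f(x)=\sum_{k\in\mathbb{Z}^d}e^{-4\pi^2t|k|^2}a_ke^{2\pi ik\cdot x}$. For $h:\mathbb{Z}_N^d\to\mathbb{C}$ the discrete Fourier transform is $\widehat h(m)=N^{-d/2}\sum_{x\in\mathbb{Z}_N^d}e^{-2\pi i x\cdot m/N}h(x)$, $m\in\mathbb{Z}_N^d$. The Fourier ratio is $FR(h)=\|\widehat h\|_1/\|\widehat h\|_2$ for $h\not\equiv 0$ and $FR(h)=0$ if $h\equiv0$, where $\|\widehat h\|_p=\left(\sum_{m}|\widehat h(m)|^p\right)^{1/p}$. The constant $C_d>0$ is a fixed constant depending only on $d$ such that for every integer $N\ge2$ and every $F\in C^2([0,1]^d)$ that is $1$-periodic in each variable, $$\left|\frac1{N^d}\sum_{x\in\mathbb{Z}_N^d}|F(x/N)|^2-\int_{[0,1]^d}|F(u)|^2\,du\right|\le\frac{C_d}{N}\|F\|_{C^2([0,1]^d)}^2 .$$ *)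

theory Defs
  imports "HOL-Analysis.Analysis"
begin

definition periodic1 :: "(real^'n \<Rightarrow> 'b) \<Rightarrow> bool" where
  "periodic1 F \<longleftrightarrow> (\<forall>x i. F (x + axis i 1) = F x)"

definition partial_deriv :: "'n \<Rightarrow> (real^'n \<Rightarrow> 'b::real_normed_vector) \<Rightarrow> real^'n \<Rightarrow> 'b" where
  "partial_deriv i F x = vector_derivative (\<lambda>s. F (x + s *\<^sub>R axis i 1)) (at 0)"

fun C_k :: "nat \<Rightarrow> (real^'n \<Rightarrow> 'b::real_normed_vector) \<Rightarrow> bool" where
  "C_k 0 F \<longleftrightarrow> continuous_on UNIV F"
| "C_k (Suc k) F \<longleftrightarrow> continuous_on UNIV F \<and>
     (\<forall>i. (\<forall>x. (\<lambda>s. F (x + s *\<^sub>R axis i 1)) differentiable (at 0)) \<and> C_k k (partial_deriv i F))"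

text \<open>A multi-index is a function \<open>\<alpha> :: 'n \<Rightarrow> nat\<close> of length \<open>\<Sum>i. \<alpha> i\<close>. An arbitrary finite index
  type carries no order, so the partial derivatives are taken in some order in which each
  direction \<open>i\<close> occurs \<open>\<alpha> i\<close> times; on functions of class \<open>C_k k\<close> with \<open>(\<Sum>i. \<alpha> i) \<le> k\<close> the order
  is irrelevant by the symmetry of mixed partial derivatives.\<close>

definition multi_deriv :: "('n::finite \<Rightarrow> nat) \<Rightarrow> (real^'n \<Rightarrow> 'b::real_normed_vector) \<Rightarrow> real^'n \<Rightarrow> 'b" where
  "multi_deriv \<alpha> F = foldr partial_deriv (SOME is. \<forall>i. count_list is i = \<alpha> i) F"

definition C_k_norm :: "nat \<Rightarrow> (real^'n::finite \<Rightarrow> 'b::real_normed_vector) \<Rightarrow> real" where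
  "C_k_norm k F =
     (\<Sum>\<alpha> | (\<Sum>i\<in>UNIV. \<alpha> i) \<le> k. SUP x\<in>cbox 0 1. norm (multi_deriv \<alpha> F x))"

definition L2_norm_cube :: "(real^'n \<Rightarrow> 'b::real_normed_vector) \<Rightarrow> real" where
  "L2_norm_cube F = sqrt (integral (cbox 0 1) (\<lambda>x. (norm (F x))\<^sup>2))"

definition int_vec :: "int^'n \<Rightarrow> real^'n" where
  "int_vec k = (\<chi> i. real_of_int (k $ i))"

definition fourier_coeff :: "(real^'n \<Rightarrow> complex) \<Rightarrow> int^'n \<Rightarrow> complex" where
  "fourier_coeff f k =
     integral (cbox 0 1) (\<lambda>x. f x * exp (- 2 * complex_of_real pi * \<i> * complex_of_real (int_vec k \<bullet> x)))"

definition heat :: "real \<Rightarrow> (real^'n \<Rightarrow> complex) \<Rightarrow> real^'n \<Rightarrow> complex" where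
  "heat t f x = (\<Sum>\<^sub>\<infinity>k\<in>UNIV. complex_of_real (exp (- 4 * pi\<^sup>2 * t * (norm (int_vec k))\<^sup>2))
      * fourier_coeff f k * exp (2 * complex_of_real pi * \<i> * complex_of_real (int_vec k \<bullet> x)))"

text \<open>\<open>(\<int>/N\<int>)\<^sup>d\<close> is represented by the residues in \<open>{0..<N}\<^sup>d\<close>; functions on it are functions on
  \<open>int^'n\<close> of which only the values at these residues matter.\<close>

definition grid :: "nat \<Rightarrow> (int^'n) set" where
  "grid N = {x. \<forall>i. 0 \<le> x $ i \<and> x $ i < int N}"

definition sample :: "nat \<Rightarrow> (real^'n \<Rightarrow> 'b) \<Rightarrow> int^'n \<Rightarrow> 'b" where
  "sample N F x = F (int_vec x /\<^sub>R real N)"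

definition dft :: "nat \<Rightarrow> (int^'n \<Rightarrow> complex) \<Rightarrow> int^'n \<Rightarrow> complex" where
  "dft N h m = complex_of_real (real N powr (- real CARD('n) / 2)) *
     (\<Sum>x\<in>grid N. exp (- 2 * complex_of_real pi * \<i> * complex_of_real (int_vec x \<bullet> int_vec m / real N)) * h x)"

definition lp_norm_grid :: "real \<Rightarrow> nat \<Rightarrow> (int^'n \<Rightarrow> complex) \<Rightarrow> real" where
  "lp_norm_grid p N h = (\<Sum>m\<in>grid N. norm (h m) powr p) powr (1 / p)"

definition fourier_ratio :: "nat \<Rightarrow> (int^'n \<Rightarrow> complex) \<Rightarrow> real" where
  "fourier_ratio N h =
     (if \<forall>x\<in>grid N. h x = 0 then 0
      else lp_norm_grid 1 N (dft N h) / lp_norm_grid 2 N (dft N h))"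

end

theory Submission
  imports Defs
begin

text \<open>
  Write $H = H_t f$. Its Fourier coefficients $c_k = e^{-4\pi^2 t|k|^2} a_k$ satisfy
  $|c_k| \le e^{-4\pi^2 t|k|^2}\,\|f\|_{C^2}$, since $|a_k| \le \sup|f|$
  (\<open>norm_fourier_coeff_le\<close>, \<open>norm_le_C_k_norm\<close>). Hence $\sum_k |c_k| \le S\,\|f\|_{C^2}$, where
  $S = \sum_k e^{-4\pi^2 t|k|^2}$ depends only on $d$ and $t$, because the Gaussian
  weights are summable over the lattice (\<open>gaussian_summable\<close>).

  The transform of the samples of $H$ at a frequency $m$ collects all $c_k$ with $k \equiv m$ modulo $N$, so
  $\|\widehat{g}\|_1 \le N^{d/2} \sum_k |c_k|$ (\<open>dft_trig_series_l1_le\<close>). In the denominator, Plancherel's identity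
  on the grid (\<open>plancherel_grid\<close>) turns $\|\widehat{g}\|_2^2$ into $\sum_x |g(x)|^2$, and the Riemann sum estimate
  together with the lower bound on $\|H\|_{L^2}$ shows that this is at least
  $\frac34 N^d \|H\|_{L^2}^2$, so that $\|\widehat{g}\|_2 \ge \frac12 N^{d/2} \|H\|_{L^2}$. The factors $N^{d/2}$ cancel and
  $FR(g) \le 2 S \|f\|_{C^2}/\|H\|_{L^2}$, which is the term $B$ with $C_4 = 2S$; the other two terms only
  enlarge the right-hand side.

  The Riemann sum estimate may be applied to $H$ because $H$ is of class $C^2$. This holds for every
  trigonometric series whose coefficients have finite moments of all orders
  (\<open>C_k_trig_series\<close>), and Gaussian weights times a bounded sequence are of this kind
  (\<open>gaussian_rapidly_decaying\<close>).
\<close>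

section \<open>Sums over boxes of integer vectors\<close>

text \<open>Both the orthogonality of characters on the grid and the convergence of Gaussian sums on the lattice
  reduce to one coordinate through this factorisation.\<close>

lemma sum_prod_over_vectors:
  fixes f :: "'n::finite \<Rightarrow> int \<Rightarrow> 'b::comm_semiring_1"
  assumes "finite A"
  shows "(\<Sum>x | \<forall>i. x $ i \<in> A. \<Prod>i\<in>UNIV. f i (x $ i)) = (\<Prod>i\<in>UNIV. \<Sum>a\<in>A. f i a)"
proof -
  have "(\<Prod>i\<in>UNIV. \<Sum>a\<in>A. f i a) = (\<Sum>g\<in>PiE UNIV (\<lambda>_. A). \<Prod>i\<in>UNIV. f i (g i))"
    by (rule prod_sum_PiE) (use assms in auto)
  also have "\<dots> = (\<Sum>x | \<forall>i. x $ i \<in> A. \<Prod>i\<in>UNIV. f i (x $ i))"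
    by (rule sum.reindex_bij_witness[of _ vec_nth vec_lambda]) (auto simp: PiE_def)
  finally show ?thesis ..
qed

lemma finite_vectors_over:
  assumes "finite (A :: int set)"
  shows "finite {x :: int^'n. \<forall>i. x $ i \<in> A}"
proof -
  have "{x :: int^'n. \<forall>i. x $ i \<in> A} \<subseteq> vec_lambda ` PiE UNIV (\<lambda>_. A)"
  proof
    fix x :: "int^'n" assume "x \<in> {x. \<forall>i. x $ i \<in> A}"
    then have "vec_nth x \<in> PiE UNIV (\<lambda>_. A)" by auto
    then show "x \<in> vec_lambda ` PiE UNIV (\<lambda>_. A)"
      by (metis imageI vec_nth_inverse)
  qed
  moreover have "finite (PiE (UNIV :: 'n set) (\<lambda>_. A))"
    using assms by (intro finite_PiE) auto
  ultimately show ?thesis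
    by (meson finite_imageI finite_subset)
qed

lemma grid_eq: "grid N = {x. \<forall>i. x $ i \<in> {0..<int N}}"
  by (simp add: grid_def)

lemma finite_grid: "finite (grid N)"
  unfolding grid_eq by (rule finite_vectors_over) simp

section \<open>Characters\<close>

text \<open>The additive character $u \mapsto e^{2\pi i u}$; every exponential in the discrete and in the
  continuous Fourier transform is one of its values.\<close>

definition wave :: "real \<Rightarrow> complex" where
  "wave u = exp (2 * complex_of_real pi * \<i> * complex_of_real u)"

lemma wave_add: "wave (u + v) = wave u * wave v"
  by (simp add: wave_def exp_add [symmetric] algebra_simps)

lemma wave_0 [simp]: "wave 0 = 1"
  by (simp add: wave_def)

lemma norm_wave [simp]: "norm (wave u) = 1"
  by (simp add: wave_def)

lemma wave_minus: "wave (- u) = cnj (wave u)"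
  by (simp add: wave_def exp_cnj)

lemma wave_sum: "wave (\<Sum>i\<in>A. u i) = (\<Prod>i\<in>A. wave (u i))"
  by (induction A rule: infinite_finite_induct) (simp_all add: wave_add)

lemma wave_eq_1_iff: "wave u = 1 \<longleftrightarrow> u \<in> \<int>"
proof -
  have "wave u = 1 \<longleftrightarrow> (\<exists>n::int. u = of_int n)"
    by (auto simp: wave_def exp_eq_1 field_simps)
  then show ?thesis by (auto simp: Ints_def)
qed

lemma wave_of_nat_mult: "wave (real n * u) = wave u ^ n"
  by (induction n) (simp_all add: wave_add distrib_right)

lemma wave_minus_1_le: "norm (wave u - 1) \<le> 2 * pi * \<bar>u\<bar>"
  using Taylor_exp[of "2 * complex_of_real pi * \<i> * complex_of_real u" 0]
  by (simp add: wave_def norm_mult)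

lemma wave_linear_approx: "norm (wave u - 1 - 2 * of_real pi * \<i> * of_real u) \<le> (2 * pi * u)\<^sup>2"
  using Taylor_exp[of "2 * complex_of_real pi * \<i> * complex_of_real u" 1]
  by (simp add: wave_def norm_mult power2_eq_square abs_mult diff_diff_eq)

text \<open>A geometric sum whose ratio is an $N$-th root of unity.\<close>

lemma sum_wave_residues:
  assumes "N > 0"
  shows "(\<Sum>a\<in>{0..<int N}. wave (real_of_int a * real_of_int j / real N)) =
    (if int N dvd j then of_nat N else 0)"
proof -
  define q where "q = wave (real_of_int j / real N)"
  have "(\<Sum>a\<in>{0..<int N}. wave (real_of_int a * real_of_int j / real N)) = (\<Sum>n<N. q ^ n)"
    by (rule sum.reindex_bij_witness[of _ int nat])
       (auto simp: q_def wave_of_nat_mult [symmetric])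
  moreover have "q = 1 \<longleftrightarrow> int N dvd j"
  proof -
    have "real_of_int j / real N \<in> \<int> \<longleftrightarrow> int N dvd j"
    proof
      assume "real_of_int j / real N \<in> \<int>"
      then obtain z where "real_of_int j / real N = of_int z" by (auto elim: Ints_cases)
      then have "real_of_int j = of_int (int N * z)" using assms by (simp add: field_simps)
      then show "int N dvd j" using of_int_eq_iff by (metis dvd_triv_left)
    qed (use assms in \<open>auto elim!: dvdE\<close>)
    then show ?thesis by (simp add: q_def wave_eq_1_iff)
  qed
  moreover have "q ^ N = 1"
    using assms by (simp add: q_def wave_of_nat_mult [symmetric] wave_eq_1_iff)
  ultimately show ?thesis
    by (auto simp: sum_gp_strict)
qed

lemma int_vec_simps:
  "int_vec (k - l) = int_vec k - int_vec l"
  "int_vec k $ i = real_of_int (k $ i)"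
  by (simp_all add: int_vec_def vec_eq_iff)

section \<open>The discrete Fourier transform on the grid\<close>

lemma grid_orthogonality:
  fixes j :: "int^'n"
  assumes "N > 0"
  shows "(\<Sum>x\<in>grid N. wave (int_vec x \<bullet> int_vec j / real N)) =
    (if \<forall>i. int N dvd j $ i then of_nat (N ^ CARD('n)) else 0)"
proof -
  have "(\<Sum>x\<in>grid N. wave (int_vec x \<bullet> int_vec j / real N)) =
    (\<Sum>x\<in>grid N. \<Prod>i\<in>UNIV. wave (real_of_int (x $ i) * real_of_int (j $ i) / real N))"
    by (simp add: inner_vec_def int_vec_simps sum_divide_distrib wave_sum)
  also have "\<dots> = (\<Prod>i\<in>UNIV. \<Sum>a\<in>{0..<int N}. wave (real_of_int a * real_of_int (j $ i) / real N))"
    unfolding grid_eq by (rule sum_prod_over_vectors) simp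
  also have "\<dots> = (if \<forall>i. int N dvd j $ i then of_nat (N ^ CARD('n)) else 0)"
    using assms by (auto simp: sum_wave_residues)
  finally show ?thesis .
qed

lemma grid_congruent_imp_eq:
  assumes "x \<in> grid N" "y \<in> grid N" "\<forall>i. int N dvd (x - y) $ i"
  shows "x = y"
  unfolding vec_eq_iff
proof
  fix i
  have "x $ i mod int N = y $ i mod int N"
    using assms(3) by (simp add: mod_eq_dvd_iff)
  then show "x $ i = y $ i"
    using assms(1,2) by (simp add: grid_def)
qed

lemma ex1_grid_congruent:
  fixes k :: "int^'n"
  assumes "N > 0"
  shows "\<exists>!m. m \<in> grid N \<and> (\<forall>i. int N dvd (k - m) $ i)"
proof (rule ex1I)
  show "(\<chi> i. k $ i mod int N) \<in> grid N \<and> (\<forall>i. int N dvd (k - (\<chi> i. k $ i mod int N)) $ i)"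
    using assms by (simp add: grid_def minus_mod_eq_mult_div)
  fix m :: "int^'n" assume m: "m \<in> grid N \<and> (\<forall>i. int N dvd (k - m) $ i)"
  then have "k $ i mod int N = m $ i" for i
    by (simp add: mod_eq_dvd_iff [symmetric] grid_def)
  then show "m = (\<chi> i. k $ i mod int N)"
    by (simp add: vec_eq_iff)
qed

lemma dft_eq_sum_wave:
  fixes h :: "int^'n \<Rightarrow> complex"
  shows "dft N h m = complex_of_real (real N powr (- real CARD('n) / 2)) *
     (\<Sum>x\<in>grid N. wave (- (int_vec x \<bullet> int_vec m / real N)) * h x)"
  by (simp add: dft_def wave_def)

text \<open>Expand the square, sum over the frequency first, and let orthogonality leave only the diagonal.\<close>

lemma plancherel_grid:
  fixes h :: "int^'n \<Rightarrow> complex"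
  assumes "N > 0"
  shows "(\<Sum>m\<in>grid N. (norm (dft N h m))\<^sup>2) = (\<Sum>x\<in>grid N. (norm (h x))\<^sup>2)"
proof -
  define W where "W x m = wave (int_vec x \<bullet> int_vec m / real N)" for x m :: "int^'n"
  have pw: "(real N powr (- real CARD('n) / 2))\<^sup>2 = 1 / real N ^ CARD('n)"
    using assms by (simp add: powr_minus_divide power_divide powr_realpow [symmetric] powr_powr power2_eq_square powr_add [symmetric])
  have sq: "complex_of_real ((norm (dft N h m))\<^sup>2) =
      1 / of_nat (N ^ CARD('n)) * (\<Sum>x\<in>grid N. \<Sum>y\<in>grid N. h x * cnj (h y) * W (y - x) m)" for m
  proof -
    let ?S = "\<Sum>x\<in>grid N. cnj (W x m) * h x"
    have "dft N h m = complex_of_real (real N powr (- real CARD('n) / 2)) * ?S"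
      by (simp add: dft_eq_sum_wave W_def wave_minus)
    then have "complex_of_real ((norm (dft N h m))\<^sup>2) =
        complex_of_real ((real N powr (- real CARD('n) / 2))\<^sup>2) * (?S * cnj ?S)"
      by (simp add: norm_mult power_mult_distrib complex_norm_square [symmetric] del: cnj_sum)
    also have "?S * cnj ?S = (\<Sum>x\<in>grid N. \<Sum>y\<in>grid N. h x * cnj (h y) * W (y - x) m)"
      by (simp add: sum_product W_def int_vec_simps inner_diff_left diff_divide_distrib
          wave_add [of _ "- _", simplified] wave_minus mult_ac)
    finally show ?thesis by (simp only: pw) simp
  qed
  have "complex_of_real (\<Sum>m\<in>grid N. (norm (dft N h m))\<^sup>2) =
     1 / of_nat (N ^ CARD('n)) * (\<Sum>m\<in>grid N. \<Sum>x\<in>grid N. \<Sum>y\<in>grid N. h x * cnj (h y) * W (y - x) m)"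
    by (simp add: sq sum_distrib_left del: of_real_power)
  also have "(\<Sum>m\<in>grid N. \<Sum>x\<in>grid N. \<Sum>y\<in>grid N. h x * cnj (h y) * W (y - x) m) =
     (\<Sum>x\<in>grid N. \<Sum>y\<in>grid N. \<Sum>m\<in>grid N. h x * cnj (h y) * W (y - x) m)"
    by (subst sum.swap, rule sum.cong [OF refl], rule sum.swap)
  also have "\<dots> = (\<Sum>x\<in>grid N. \<Sum>y\<in>grid N. h x * cnj (h y) * (\<Sum>m\<in>grid N. W (y - x) m))"
    by (simp add: sum_distrib_left)
  also have "\<dots> = (\<Sum>x\<in>grid N. \<Sum>y\<in>grid N. if y = x then h x * cnj (h y) * of_nat (N ^ CARD('n)) else 0)"
  proof (intro sum.cong refl)
    fix x y :: "int^'n" assume "x \<in> grid N" "y \<in> grid N"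
    then have "(\<forall>i. int N dvd (y - x) $ i) \<longleftrightarrow> y = x"
      using grid_congruent_imp_eq by fastforce
    moreover have "(\<Sum>m\<in>grid N. W (y - x) m) =
        (if \<forall>i. int N dvd (y - x) $ i then of_nat (N ^ CARD('n)) else 0)"
      unfolding W_def using grid_orthogonality [OF assms, of "y - x"] by (simp add: inner_commute)
    ultimately show "h x * cnj (h y) * (\<Sum>m\<in>grid N. W (y - x) m) =
        (if y = x then h x * cnj (h y) * of_nat (N ^ CARD('n)) else 0)"
      by simp
  qed
  also have "\<dots> = of_nat (N ^ CARD('n)) * (\<Sum>x\<in>grid N. h x * cnj (h x))"
    by (simp add: sum.delta finite_grid sum_distrib_left mult_ac)
  also have "1 / of_nat (N ^ CARD('n)) * \<dots> = complex_of_real (\<Sum>x\<in>grid N. (norm (h x))\<^sup>2)"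
    using assms by (simp add: complex_norm_square del: of_real_power)
  finally show ?thesis by (simp only: of_real_eq_iff)
qed

section \<open>Finite combinations of unconditionally convergent series\<close>

lemma has_sum_sum:
  fixes f :: "'a \<Rightarrow> 'b \<Rightarrow> 'c::topological_comm_monoid_add"
  assumes "finite I" "\<And>i. i \<in> I \<Longrightarrow> (f i has_sum s i) A"
  shows "((\<lambda>x. \<Sum>i\<in>I. f i x) has_sum (\<Sum>i\<in>I. s i)) A"
  using assms by (induction I rule: finite_induct) (auto intro!: has_sum_add)

lemma has_sum_difference:
  fixes f g :: "'a \<Rightarrow> 'b::real_normed_vector"
  assumes "(f has_sum a) A" "(g has_sum b) A"
  shows "((\<lambda>x. f x - g x) has_sum a - b) A"
  using has_sum_add [OF assms(1), of "\<lambda>x. - g x" "- b"] assms(2) by (simp add: has_sum_uminus)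

section \<open>Gaussian weights and rapid decay on the integer lattice\<close>

text \<open>Each power of $q$ occurs at $j$ and at $-j$; the zeroth is counted twice on the right.\<close>

lemma sum_two_sided_geometric_le:
  fixes q :: real
  assumes "0 \<le> q"
  shows "(\<Sum>j\<in>{- int M..int M}. q ^ nat \<bar>j\<bar>) \<le> 2 * (\<Sum>n\<le>M. q ^ n)"
proof (induction M)
  case (Suc M)
  have "{- int (Suc M)..int (Suc M)} = insert (int (Suc M)) (insert (- int (Suc M)) {- int M..int M})"
    by auto
  then have "(\<Sum>j\<in>{- int (Suc M)..int (Suc M)}. q ^ nat \<bar>j\<bar>) =
      2 * q ^ Suc M + (\<Sum>j\<in>{- int M..int M}. q ^ nat \<bar>j\<bar>)"
    by (simp add: nat_add_distrib)
  with Suc show ?case by simp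
qed simp

text \<open>Since $j^2 \ge |j|$ on the integers, a geometric series dominates.\<close>

lemma sum_gaussian_int_le:
  assumes "b > 0"
  shows "(\<Sum>j\<in>{- int M..int M}. exp (- b * (real_of_int j)\<^sup>2)) \<le> 2 / (1 - exp (- b))"
proof -
  have "exp (- b * (real_of_int j)\<^sup>2) \<le> exp (- b) ^ nat \<bar>j\<bar>" for j
  proof -
    have "\<bar>j\<bar> \<le> j\<^sup>2"
    proof (cases "j = 0")
      case False
      then have "\<bar>j\<bar> * 1 \<le> \<bar>j\<bar> * \<bar>j\<bar>" by (intro mult_left_mono) auto
      then show ?thesis by (simp add: power2_eq_square)
    qed simp
    then have "real (nat \<bar>j\<bar>) \<le> (real_of_int j)\<^sup>2"
      by (metis of_int_abs of_int_le_iff of_int_power of_nat_nat abs_ge_zero of_int_of_nat_eq)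
    then show ?thesis
      using assms by (simp add: exp_of_nat_mult [symmetric] mult_ac mult_left_mono)
  qed
  then have "(\<Sum>j\<in>{- int M..int M}. exp (- b * (real_of_int j)\<^sup>2)) \<le> (\<Sum>j\<in>{- int M..int M}. exp (- b) ^ nat \<bar>j\<bar>)"
    by (intro sum_mono)
  also have "\<dots> \<le> 2 * (\<Sum>n\<le>M. exp (- b) ^ n)"
    by (rule sum_two_sided_geometric_le) simp
  also have "\<dots> \<le> 2 * (\<Sum>n. exp (- b) ^ n)"
    using assms by (intro mult_left_mono sum_le_suminf summable_geometric) auto
  also have "\<dots> = 2 / (1 - exp (- b))"
    using assms by (simp add: suminf_geometric)
  finally show ?thesis .
qed

lemma norm_int_vec_power2: "(norm (int_vec k))\<^sup>2 = (\<Sum>i\<in>UNIV. (real_of_int (k $ i))\<^sup>2)"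
  unfolding power2_norm_eq_inner by (simp add: inner_vec_def int_vec_simps power2_eq_square)

text \<open>A finite set of lattice points lies in a box, and over a box the Gaussian sum is the product of the
  one-dimensional sums, so all partial sums have a common bound.\<close>

lemma gaussian_summable:
  assumes "b > 0"
  shows "(\<lambda>k :: int^'n. exp (- b * (norm (int_vec k))\<^sup>2)) summable_on UNIV"
proof (rule nonneg_bdd_above_summable_on)
  define g where "g j = exp (- b * (real_of_int j)\<^sup>2)" for j :: int
  have prod: "exp (- b * (norm (int_vec k))\<^sup>2) = (\<Prod>i\<in>UNIV. g (k $ i))" for k :: "int^'n"
    by (simp add: norm_int_vec_power2 g_def exp_sum [symmetric] sum_distrib_left sum_negf)
  have "sum (\<lambda>k. exp (- b * (norm (int_vec k))\<^sup>2)) F \<le> (2 / (1 - exp (- b))) ^ CARD('n)"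
    if "finite F" for F :: "(int^'n) set"
  proof -
    define M where "M = (\<Sum>k\<in>F. \<Sum>i\<in>UNIV. nat \<bar>k $ i\<bar>)"
    have "nat \<bar>k $ i\<bar> \<le> M" if "k \<in> F" for k i
    proof -
      have "nat \<bar>k $ i\<bar> \<le> (\<Sum>i\<in>UNIV. nat \<bar>k $ i\<bar>)"
        by (rule member_le_sum) auto
      also have "\<dots> \<le> M"
        unfolding M_def using that \<open>finite F\<close> by (intro member_le_sum) auto
      finally show ?thesis .
    qed
    then have F_sub: "F \<subseteq> {k. \<forall>i. k $ i \<in> {- int M..int M}}"
      by (auto simp: nat_le_iff abs_le_iff minus_le_iff)
    have "sum (\<lambda>k. exp (- b * (norm (int_vec k))\<^sup>2)) F
        \<le> (\<Sum>k :: int^'n | \<forall>i. k $ i \<in> {- int M..int M}. exp (- b * (norm (int_vec k))\<^sup>2))"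
      by (rule sum_mono2 [OF finite_vectors_over F_sub]) simp_all
    also have "\<dots> = (\<Prod>i\<in>(UNIV :: 'n set). \<Sum>j\<in>{- int M..int M}. g j)"
      unfolding prod by (rule sum_prod_over_vectors) simp
    also have "\<dots> = (\<Sum>j\<in>{- int M..int M}. g j) ^ CARD('n)"
      by simp
    also have "\<dots> \<le> (2 / (1 - exp (- b))) ^ CARD('n)"
      unfolding g_def by (intro power_mono sum_gaussian_int_le assms sum_nonneg) simp
    finally show ?thesis .
  qed
  then show "bdd_above (sum (\<lambda>k :: int^'n. exp (- b * (norm (int_vec k))\<^sup>2)) ` {F. F \<subseteq> UNIV \<and> finite F})"
    by (intro bdd_aboveI2) auto
qed simp

text \<open>Moments of every order are required so that the class is stable under termwise differentiation,
  which multiplies the coefficient at $k$ by a factor of size $|k|$.\<close>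

definition rapidly_decaying :: "(int^'n \<Rightarrow> 'b::real_normed_vector) \<Rightarrow> bool" where
  "rapidly_decaying c \<longleftrightarrow> (\<forall>p. (\<lambda>k. norm (int_vec k) ^ p * norm (c k)) summable_on UNIV)"

text \<open>From $r \le e^r$ and the inequality of means $p r \le p^2/(4a) + a r^2$.\<close>

lemma power_le_exp_square:
  fixes r a :: real
  assumes "r \<ge> 0" "a > 0"
  shows "r ^ p \<le> exp ((real p)\<^sup>2 / (4 * a)) * exp (a * r\<^sup>2)"
proof -
  have "r ^ p \<le> exp r ^ p"
    using assms exp_ge_add_one_self [of r] by (intro power_mono) linarith+
  also have "\<dots> = exp (real p * r)"
    by (simp add: exp_of_nat_mult)
  also have "real p * r \<le> (real p)\<^sup>2 / (4 * a) + a * r\<^sup>2"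
  proof -
    have "0 \<le> (real p - 2 * a * r)\<^sup>2 / (4 * a)" using assms by simp
    also have "\<dots> = (real p)\<^sup>2 / (4 * a) + a * r\<^sup>2 - real p * r"
      using assms by (simp add: field_simps power2_eq_square)
    finally show ?thesis by simp
  qed
  finally show ?thesis by (simp add: exp_add)
qed

text \<open>Half of the Gaussian exponent absorbs the power of $|k|$, and the other half is still summable.\<close>

lemma gaussian_rapidly_decaying:
  assumes "b > 0" "\<And>k. norm (a k) \<le> M"
  shows "rapidly_decaying (\<lambda>k :: int^'n. of_real (exp (- b * (norm (int_vec k))\<^sup>2)) * (a k :: complex))"
  unfolding rapidly_decaying_def
proof
  fix p
  define E where "E = exp ((real p)\<^sup>2 / (4 * (b / 2)))"
  have "M \<ge> 0" using assms(2) [of 0] norm_ge_zero order_trans by blast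
  show "(\<lambda>k :: int^'n. norm (int_vec k) ^ p * norm (of_real (exp (- b * (norm (int_vec k))\<^sup>2)) * a k)) summable_on UNIV"
  proof (rule summable_on_comparison_test)
    show "(\<lambda>k :: int^'n. E * M * exp (- (b / 2) * (norm (int_vec k))\<^sup>2)) summable_on UNIV"
      using assms(1) by (intro summable_on_cmult_right gaussian_summable) simp
    fix k :: "int^'n"
    have "norm (int_vec k) ^ p * norm (of_real (exp (- b * (norm (int_vec k))\<^sup>2)) * a k) \<le>
      (E * exp (b / 2 * (norm (int_vec k))\<^sup>2)) * (exp (- b * (norm (int_vec k))\<^sup>2) * M)"
      unfolding norm_mult E_def using assms \<open>M \<ge> 0\<close>
      by (intro mult_mono power_le_exp_square) auto
    also have "\<dots> = E * M * (exp (b / 2 * (norm (int_vec k))\<^sup>2) * exp (- b * (norm (int_vec k))\<^sup>2))"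
      by (simp add: mult_ac)
    also have "\<dots> = E * M * exp (- (b / 2) * (norm (int_vec k))\<^sup>2)"
      by (simp add: exp_add [symmetric])
    finally show "norm (int_vec k) ^ p * norm (of_real (exp (- b * (norm (int_vec k))\<^sup>2)) * a k) \<le> \<dots>" .
  qed auto
qed

section \<open>Trigonometric series with rapidly decaying coefficients\<close>

definition trig_series :: "(int^'n \<Rightarrow> complex) \<Rightarrow> real^'n \<Rightarrow> complex" where
  "trig_series c x = (\<Sum>\<^sub>\<infinity>k. c k * wave (int_vec k \<bullet> x))"

lemma rapidly_decaying_abs_summable:
  "rapidly_decaying c \<Longrightarrow> (\<lambda>k. norm (c k)) summable_on UNIV"
  unfolding rapidly_decaying_def by (drule spec [of _ 0]) simp

lemma rapidly_decaying_moment: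
  "rapidly_decaying c \<Longrightarrow> (\<lambda>k. norm (int_vec k) ^ p * norm (c k)) summable_on UNIV"
  by (simp add: rapidly_decaying_def)

lemma trig_series_has_sum:
  assumes "(\<lambda>k. norm (c k)) summable_on UNIV"
  shows "((\<lambda>k. c k * wave (int_vec k \<bullet> x)) has_sum trig_series c x) UNIV"
  unfolding trig_series_def
  by (rule has_sum_infsum [OF abs_summable_summable]) (simp add: norm_mult assms)

lemma periodic1_trig_series:
  fixes c :: "int^'n \<Rightarrow> complex"
  shows "periodic1 (trig_series c)"
  unfolding periodic1_def
proof (intro allI)
  fix x :: "real^'n" and i :: 'n
  have "wave (int_vec k \<bullet> (x + axis i 1)) = wave (int_vec k \<bullet> x)" for k :: "int^'n"
  proof -
    have "int_vec k \<bullet> (x + axis i 1) = int_vec k \<bullet> x + real_of_int (k $ i)"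
      by (simp add: inner_add_right inner_axis int_vec_simps)
    moreover have "wave (real_of_int (k $ i)) = 1"
      by (simp add: wave_eq_1_iff)
    ultimately show ?thesis
      by (simp only: wave_add mult_1_right)
  qed
  then show "trig_series c (x + axis i 1) = trig_series c x"
    by (simp only: trig_series_def)
qed

text \<open>Each character $e^{2\pi i k\cdot x}$ is Lipschitz with constant $2\pi|k|$.\<close>

lemma trig_series_lipschitz:
  fixes c :: "int^'n \<Rightarrow> complex"
  assumes "rapidly_decaying c"
  shows "norm (trig_series c y - trig_series c x) \<le>
     2 * pi * norm (y - x) * (\<Sum>\<^sub>\<infinity>k. norm (int_vec k) * norm (c k))"
proof (rule norm_infsum_le)
  note abs = rapidly_decaying_abs_summable [OF assms]
  show "((\<lambda>k. c k * wave (int_vec k \<bullet> y) - c k * wave (int_vec k \<bullet> x)) has_sum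
      (trig_series c y - trig_series c x)) UNIV"
    by (intro has_sum_difference trig_series_has_sum abs)
  show "((\<lambda>k. 2 * pi * norm (y - x) * (norm (int_vec k) * norm (c k))) has_sum
      2 * pi * norm (y - x) * (\<Sum>\<^sub>\<infinity>k. norm (int_vec k) * norm (c k))) UNIV"
    using rapidly_decaying_moment [OF assms, of 1]
    by (intro has_sum_cmult_right has_sum_infsum) simp
  fix k :: "int^'n"
  define u where "u = int_vec k \<bullet> (y - x)"
  have "int_vec k \<bullet> y = int_vec k \<bullet> x + u"
    by (simp add: u_def inner_diff_right)
  then have "c k * wave (int_vec k \<bullet> y) - c k * wave (int_vec k \<bullet> x) =
     c k * wave (int_vec k \<bullet> x) * (wave u - 1)"
    by (simp add: algebra_simps wave_add)
  then have "norm (c k * wave (int_vec k \<bullet> y) - c k * wave (int_vec k \<bullet> x)) =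
     norm (c k) * norm (wave u - 1)"
    by (simp only: norm_mult norm_wave mult_1_right)
  moreover have "norm (wave u - 1) \<le> 2 * pi * (norm (int_vec k) * norm (y - x))"
    using wave_minus_1_le [of u] Cauchy_Schwarz_ineq2 [of "int_vec k" "y - x"]
    unfolding u_def by (rule order_trans [OF _ mult_left_mono]) simp
  then have "norm (c k) * norm (wave u - 1) \<le> norm (c k) * (2 * pi * (norm (int_vec k) * norm (y - x)))"
    by (rule mult_left_mono) simp
  ultimately show "norm (c k * wave (int_vec k \<bullet> y) - c k * wave (int_vec k \<bullet> x)) \<le>
      2 * pi * norm (y - x) * (norm (int_vec k) * norm (c k))"
    by (simp only: mult_ac)
qed

lemma continuous_trig_series:
  assumes "rapidly_decaying c"
  shows "continuous_on UNIV (trig_series c)"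
proof (rule lipschitz_on_continuous_on)
  show "(2 * pi * (\<Sum>\<^sub>\<infinity>k. norm (int_vec k) * norm (c k)))-lipschitz_on UNIV (trig_series c)"
  proof (rule lipschitz_onI)
    show "dist (trig_series c x) (trig_series c y) \<le>
        2 * pi * (\<Sum>\<^sub>\<infinity>k. norm (int_vec k) * norm (c k)) * dist x y" for x y
      using trig_series_lipschitz [OF assms, of x y] by (simp add: dist_norm mult_ac)
  qed (intro mult_nonneg_nonneg infsum_nonneg; simp)
qed

text \<open>The coefficients of the partial derivative in direction $i$.\<close>

definition diff_coeff :: "'n \<Rightarrow> (int^'n \<Rightarrow> complex) \<Rightarrow> int^'n \<Rightarrow> complex" where
  "diff_coeff i c k = 2 * of_real pi * \<i> * of_int (k $ i) * c k"

lemma abs_component_le_norm_int_vec: "\<bar>real_of_int (k $ i)\<bar> \<le> norm (int_vec k)"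
  using component_le_norm_cart [of "int_vec k" i] by (simp add: int_vec_simps)

lemma rapidly_decaying_diff_coeff:
  assumes "rapidly_decaying c"
  shows "rapidly_decaying (diff_coeff i c)"
  unfolding rapidly_decaying_def
proof
  fix p
  show "(\<lambda>k. norm (int_vec k) ^ p * norm (diff_coeff i c k)) summable_on UNIV"
  proof (rule summable_on_comparison_test)
    show "(\<lambda>k. 2 * pi * (norm (int_vec k) ^ Suc p * norm (c k))) summable_on UNIV"
      by (intro summable_on_cmult_right rapidly_decaying_moment assms)
    fix k :: "int^'a"
    have "norm (int_vec k) ^ p * (2 * pi * \<bar>real_of_int (k $ i)\<bar> * norm (c k)) \<le>
       norm (int_vec k) ^ p * (2 * pi * norm (int_vec k) * norm (c k))"
      using abs_component_le_norm_int_vec [of k i]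
      by (intro mult_left_mono mult_right_mono) auto
    then show "norm (int_vec k) ^ p * norm (diff_coeff i c k) \<le>
        2 * pi * (norm (int_vec k) ^ Suc p * norm (c k))"
      by (simp add: diff_coeff_def norm_mult mult_ac)
  qed simp
qed

text \<open>A quadratic remainder estimate passes through an infinite sum term by term, so this criterion turns
  termwise differentiation into a single norm estimate.\<close>

lemma has_vector_derivative_quadratic:
  fixes \<phi> :: "real \<Rightarrow> 'b::real_normed_vector"
  assumes "\<And>s. norm (\<phi> s - \<phi> 0 - s *\<^sub>R D) \<le> K * s\<^sup>2"
  shows "(\<phi> has_vector_derivative D) (at 0)"
  unfolding has_vector_derivative_def has_derivative_at
proof (intro conjI bounded_linear_scaleR_left)
  have "((\<lambda>h. K * \<bar>h\<bar>) \<longlongrightarrow> K * \<bar>0::real\<bar>) (at 0)"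
    by (intro tendsto_intros)
  then have "((\<lambda>h::real. K * \<bar>h\<bar>) \<longlongrightarrow> 0) (at 0)" by simp
  then show "(\<lambda>h. norm (\<phi> (0 + h) - \<phi> 0 - h *\<^sub>R D) / norm h) \<midarrow>0\<rightarrow> 0"
  proof (rule Lim_null_comparison [rotated], intro eventuallyI)
    fix h :: real
    show "norm (norm (\<phi> (0 + h) - \<phi> 0 - h *\<^sub>R D) / norm h) \<le> K * \<bar>h\<bar>"
      using assms [of h] by (cases "h = 0") (auto simp: divide_le_eq power2_eq_square mult_ac)
  qed
qed

text \<open>The remainder of the $k$-th term is at most $|c_k|(2\pi s|k|)^2$, and the second moment sums these.\<close>

lemma trig_series_has_partial_deriv:
  assumes "rapidly_decaying c"
  shows "((\<lambda>s. trig_series c (x + s *\<^sub>R axis i 1)) has_vector_derivative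
     trig_series (diff_coeff i c) x) (at 0)"
proof (rule has_vector_derivative_quadratic)
  fix s :: real
  note abs = rapidly_decaying_abs_summable [OF assms]
    rapidly_decaying_abs_summable [OF rapidly_decaying_diff_coeff [OF assms]]
  have "norm (trig_series c (x + s *\<^sub>R axis i 1) - trig_series c x - s *\<^sub>R trig_series (diff_coeff i c) x)
     \<le> (2 * pi * s)\<^sup>2 * (\<Sum>\<^sub>\<infinity>k. norm (int_vec k) ^ 2 * norm (c k))"
  proof (rule norm_infsum_le)
    show "((\<lambda>k. c k * wave (int_vec k \<bullet> (x + s *\<^sub>R axis i 1)) - c k * wave (int_vec k \<bullet> x)
        - s *\<^sub>R (diff_coeff i c k * wave (int_vec k \<bullet> x))) has_sum
       (trig_series c (x + s *\<^sub>R axis i 1) - trig_series c x - s *\<^sub>R trig_series (diff_coeff i c) x)) UNIV"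
      unfolding scaleR_conv_of_real
      by (intro has_sum_difference has_sum_cmult_right trig_series_has_sum abs)
    show "((\<lambda>k. (2 * pi * s)\<^sup>2 * (norm (int_vec k) ^ 2 * norm (c k))) has_sum
        (2 * pi * s)\<^sup>2 * (\<Sum>\<^sub>\<infinity>k. norm (int_vec k) ^ 2 * norm (c k))) UNIV"
      by (intro has_sum_cmult_right has_sum_infsum rapidly_decaying_moment assms)
    fix k :: "int^'a"
    define u where "u = s * real_of_int (k $ i)"
    have shift: "int_vec k \<bullet> (x + s *\<^sub>R axis i 1) = int_vec k \<bullet> x + u"
      by (simp add: u_def inner_add_right inner_axis int_vec_simps)
    have "c k * wave (int_vec k \<bullet> (x + s *\<^sub>R axis i 1)) - c k * wave (int_vec k \<bullet> x)
        - s *\<^sub>R (diff_coeff i c k * wave (int_vec k \<bullet> x)) =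
        c k * wave (int_vec k \<bullet> x) * (wave u - 1 - 2 * of_real pi * \<i> * of_real u)"
      unfolding shift wave_add
      by (simp add: u_def diff_coeff_def scaleR_conv_of_real algebra_simps)
    then have "norm (c k * wave (int_vec k \<bullet> (x + s *\<^sub>R axis i 1)) - c k * wave (int_vec k \<bullet> x)
        - s *\<^sub>R (diff_coeff i c k * wave (int_vec k \<bullet> x))) =
        norm (c k) * norm (wave u - 1 - 2 * of_real pi * \<i> * of_real u)"
      by (simp add: norm_mult)
    also have "\<dots> \<le> norm (c k) * (2 * pi * u)\<^sup>2"
      by (intro mult_left_mono wave_linear_approx) simp
    also have "\<dots> = (2 * pi * s)\<^sup>2 * (\<bar>real_of_int (k $ i)\<bar> ^ 2 * norm (c k))"
      by (simp add: u_def power_mult_distrib mult_ac)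
    also have "\<dots> \<le> (2 * pi * s)\<^sup>2 * (norm (int_vec k) ^ 2 * norm (c k))"
      by (intro mult_left_mono mult_right_mono power_mono abs_component_le_norm_int_vec) auto
    finally show "norm (c k * wave (int_vec k \<bullet> (x + s *\<^sub>R axis i 1)) - c k * wave (int_vec k \<bullet> x)
        - s *\<^sub>R (diff_coeff i c k * wave (int_vec k \<bullet> x))) \<le> \<dots>" .
  qed
  then show "norm (trig_series c (x + s *\<^sub>R axis i 1) - trig_series c (x + 0 *\<^sub>R axis i 1)
      - s *\<^sub>R trig_series (diff_coeff i c) x)
     \<le> ((2 * pi)\<^sup>2 * (\<Sum>\<^sub>\<infinity>k. norm (int_vec k) ^ 2 * norm (c k))) * s\<^sup>2"
    by (simp only: scaleR_zero_left add_0_right power_mult_distrib mult_ac)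
qed

lemma C_k_trig_series: "rapidly_decaying c \<Longrightarrow> C_k n (trig_series c)"
proof (induction n arbitrary: c)
  case 0
  then show ?case by (simp add: continuous_trig_series)
next
  case (Suc n)
  have "partial_deriv i (trig_series c) = trig_series (diff_coeff i c)" for i
    unfolding partial_deriv_def
    by (intro ext vector_derivative_at trig_series_has_partial_deriv Suc.prems)
  moreover have "(\<lambda>s. trig_series c (x + s *\<^sub>R axis i 1)) differentiable (at 0)" for x i
    using trig_series_has_partial_deriv [OF Suc.prems] differentiableI_vector by blast
  ultimately show ?case
    by (simp add: continuous_trig_series Suc.prems Suc.IH rapidly_decaying_diff_coeff)
qed

section \<open>The $C^k$ norm bounds the Fourier coefficients\<close>

lemma C_k_imp_continuous: "C_k k F \<Longrightarrow> continuous_on UNIV F"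
  by (cases k) auto

text \<open>Continuity of the iterated derivatives holds for any order of the directions, so the unspecified
  order chosen by \<^const>\<open>multi_deriv\<close> does no harm.\<close>

lemma C_k_foldr_partial_deriv:
  "C_k (length is + m) F \<Longrightarrow> C_k m (foldr partial_deriv is F)"
proof (induction "is" arbitrary: m)
  case (Cons i "is")
  have "C_k (length is + Suc m) F" using Cons.prems by simp
  then have "C_k (Suc m) (foldr partial_deriv is F)" by (rule Cons.IH)
  then show ?case by simp
qed simp

text \<open>The choice operator in \<^const>\<open>multi_deriv\<close> is only meaningful once some list with the prescribed
  multiplicities is known to exist.\<close>

lemma ex_list_with_counts: "\<exists>is. \<forall>i::'n::finite. count_list is i = \<alpha> i"
proof -
  obtain xs :: "'n list" where xs: "set xs = UNIV" "distinct xs"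
    using finite_distinct_list [of "UNIV :: 'n set"] by auto
  have "count_list (concat (map (\<lambda>j. replicate (\<alpha> j) j) ys)) i = (if i \<in> set ys then \<alpha> i else 0)"
    if "distinct ys" for i ys
  proof -
    have rep: "count_list (replicate n j) i = (if i = j then n else 0)" for n j
      by (induction n) auto
    show ?thesis
      using that by (induction ys) (auto simp: rep)
  qed
  from this [OF xs(2)] xs(1) show ?thesis by auto
qed

lemma continuous_multi_deriv:
  assumes "C_k k F" "(\<Sum>i\<in>UNIV. \<alpha> i) \<le> k"
  shows "continuous_on UNIV (multi_deriv \<alpha> F)"
proof -
  define js where "js = (SOME is. \<forall>i. count_list is i = \<alpha> i)"
  have js: "\<forall>i. count_list js i = \<alpha> i"
    unfolding js_def using ex_list_with_counts by (rule someI_ex)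
  then have "length js = (\<Sum>i\<in>UNIV. \<alpha> i)"
    using sum_count_set [of js UNIV] by simp
  with assms have "C_k (length js + (k - length js)) F" by simp
  then show ?thesis
    unfolding multi_deriv_def js_def [symmetric]
    by (intro C_k_imp_continuous [OF C_k_foldr_partial_deriv])
qed

lemma multi_deriv_0: "multi_deriv (\<lambda>_. 0) F = F"
proof -
  define js where "js = (SOME is::'a list. \<forall>i. count_list is i = 0)"
  have "\<forall>i. count_list js i = 0"
    unfolding js_def by (rule someI_ex) (rule ex_list_with_counts)
  then have "js = []"
    by (metis count_list_0_iff list.set_intros(1) neq_Nil_conv)
  then show ?thesis
    by (simp add: multi_deriv_def js_def [symmetric])
qed

lemma finite_multi_indices: "finite {\<alpha> :: 'n::finite \<Rightarrow> nat. (\<Sum>i\<in>UNIV. \<alpha> i) \<le> k}"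
proof (rule finite_subset)
  show "{\<alpha> :: 'n \<Rightarrow> nat. (\<Sum>i\<in>UNIV. \<alpha> i) \<le> k} \<subseteq> PiE UNIV (\<lambda>_. {..k})"
  proof
    fix \<alpha> :: "'n \<Rightarrow> nat" assume "\<alpha> \<in> {\<alpha>. (\<Sum>i\<in>UNIV. \<alpha> i) \<le> k}"
    moreover have "\<alpha> i \<le> (\<Sum>i\<in>UNIV. \<alpha> i)" for i
      by (rule member_le_sum) auto
    ultimately show "\<alpha> \<in> PiE UNIV (\<lambda>_. {..k})"
      by (auto intro: le_trans)
  qed
  show "finite (PiE (UNIV :: 'n set) (\<lambda>_. {..k}))"
    by (intro finite_PiE) auto
qed

lemma norm_le_SUP_cube:
  fixes G :: "real^'n \<Rightarrow> 'b::real_normed_vector"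
  assumes "continuous_on UNIV G" "x \<in> cbox 0 1"
  shows "norm (G x) \<le> (SUP x\<in>cbox 0 1. norm (G x))"
proof (rule cSUP_upper [OF assms(2)])
  have "compact ((\<lambda>x. norm (G x)) ` cbox 0 1)"
    using assms(1) by (intro compact_continuous_image continuous_intros) (auto intro: continuous_on_subset)
  then show "bdd_above ((\<lambda>x. norm (G x)) ` cbox 0 1)"
    by (intro bounded_imp_bdd_above compact_imp_bounded)
qed

lemma zero_in_unit_cube: "0 \<in> cbox 0 (1 :: real^'n)"
  by (simp add: mem_box_cart)

text \<open>The sup norm is the summand for the zero multi-index. The other summands are non-negative, which has to
  be checked because a supremum of an unbounded real set would be unspecified.\<close>

lemma norm_le_C_k_norm:
  fixes F :: "real^'n \<Rightarrow> 'b::real_normed_vector"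
  assumes "C_k k F" "x \<in> cbox 0 1"
  shows "norm (F x) \<le> C_k_norm k F"
proof -
  have "norm (F x) \<le> (SUP x\<in>cbox 0 1. norm (multi_deriv (\<lambda>_. 0) F x))"
    unfolding multi_deriv_0 by (intro norm_le_SUP_cube C_k_imp_continuous [OF assms(1)] assms(2))
  also have "\<dots> \<le> C_k_norm k F"
    unfolding C_k_norm_def
  proof (rule member_le_sum)
    fix \<alpha> :: "'n \<Rightarrow> nat" assume "\<alpha> \<in> {\<alpha>. sum \<alpha> UNIV \<le> k} - {\<lambda>_. 0}"
    then show "0 \<le> (SUP x\<in>cbox 0 1. norm (multi_deriv \<alpha> F x))"
      using norm_le_SUP_cube [OF continuous_multi_deriv [OF assms(1)] zero_in_unit_cube]
      by (intro order_trans [OF norm_ge_zero]) auto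
  qed (simp_all add: finite_multi_indices)
  finally show ?thesis .
qed

lemma norm_fourier_coeff_le:
  fixes f :: "real^'n \<Rightarrow> complex"
  assumes "continuous_on UNIV f" "\<And>x. x \<in> cbox 0 1 \<Longrightarrow> norm (f x) \<le> M"
  shows "norm (fourier_coeff f k) \<le> M"
proof -
  let ?g = "\<lambda>x. f x * exp (- 2 * complex_of_real pi * \<i> * complex_of_real (int_vec k \<bullet> x))"
  have "?g integrable_on cbox 0 1"
    using assms(1) by (intro integrable_continuous continuous_intros) (auto intro: continuous_on_subset)
  then have "norm (integral (cbox 0 1) ?g) \<le> M * measure lborel (cbox 0 (1 :: real^'n))"
    using assms(2) order_trans [OF norm_ge_zero assms(2) [OF zero_in_unit_cube]]
    by (intro has_integral_bound [OF _ integrable_integral]) (auto simp: norm_mult)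
  also have "measure lborel (cbox 0 (1 :: real^'n)) = 1"
    using zero_in_unit_cube by (subst content_cbox_cart) auto
  finally show ?thesis by (simp add: fourier_coeff_def)
qed

section \<open>Aliasing and the Fourier ratio\<close>

text \<open>Sampling on the grid folds every frequency $k$ onto its residue modulo $N$ (aliasing): the transform at $m$
  is $N^{d/2} \sum_{k \equiv m} c_k$. Each $k$ is congruent to exactly one grid point, so summing over $m$ counts
  every $|c_k|$ once.\<close>

lemma dft_trig_series_l1_le:
  fixes c :: "int^'n \<Rightarrow> complex"
  assumes "N > 0" and c: "(\<lambda>k. norm (c k)) summable_on UNIV"
  shows "(\<Sum>m\<in>grid N. norm (dft N (sample N (trig_series c)) m)) \<le>
    real N powr (real CARD('n) / 2) * (\<Sum>\<^sub>\<infinity>k. norm (c k))"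
proof -
  define \<rho> where "\<rho> = real N powr (- real CARD('n) / 2)"
  define \<delta> where "\<delta> k m = (if \<forall>i. int N dvd (k - m) $ i then real (N ^ CARD('n)) else 0)" for k m :: "int^'n"
  have \<rho>: "\<rho> \<ge> 0" by (simp add: \<rho>_def)
  have aliasing: "((\<lambda>k. complex_of_real (\<rho> * \<delta> k m) * c k) has_sum dft N (sample N (trig_series c)) m) UNIV" for m
  proof -
    have "((\<lambda>k. of_real \<rho> * (\<Sum>x\<in>grid N. wave (- (int_vec x \<bullet> int_vec m / real N)) *
          (c k * wave (int_vec k \<bullet> (int_vec x /\<^sub>R real N))))) has_sum dft N (sample N (trig_series c)) m) UNIV"
      unfolding dft_eq_sum_wave sample_def \<rho>_def
      by (intro has_sum_cmult_right has_sum_sum finite_grid trig_series_has_sum c)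
    moreover have "(\<Sum>x\<in>grid N. wave (- (int_vec x \<bullet> int_vec m / real N)) *
          (c k * wave (int_vec k \<bullet> (int_vec x /\<^sub>R real N)))) = of_real (\<delta> k m) * c k" for k
    proof -
      have "(\<Sum>x\<in>grid N. wave (- (int_vec x \<bullet> int_vec m / real N)) *
          (c k * wave (int_vec k \<bullet> (int_vec x /\<^sub>R real N)))) =
        c k * (\<Sum>x\<in>grid N. wave (int_vec x \<bullet> int_vec (k - m) / real N))"
        unfolding sum_distrib_left
      proof (intro sum.cong refl)
        fix x :: "int^'n"
        have "int_vec x \<bullet> int_vec (k - m) / real N =
            - (int_vec x \<bullet> int_vec m / real N) + int_vec k \<bullet> (int_vec x /\<^sub>R real N)"
          by (simp add: int_vec_simps inner_diff_right right_diff_distrib inner_commute divide_inverse mult_ac)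
        then show "wave (- (int_vec x \<bullet> int_vec m / real N)) *
          (c k * wave (int_vec k \<bullet> (int_vec x /\<^sub>R real N))) =
          c k * wave (int_vec x \<bullet> int_vec (k - m) / real N)"
          by (simp only: wave_add mult_ac)
      qed
      then show ?thesis
        by (simp only: grid_orthogonality [OF assms(1)]) (simp add: \<delta>_def)
    qed
    ultimately show ?thesis by (simp add: mult_ac)
  qed
  \<comment> \<open>for fixed \<open>k\<close> only the residue of \<open>k\<close> contributes, so the bound below does not grow with the number of grid points\<close>
  have one_residue: "(\<Sum>m\<in>grid N. \<delta> k m) = real (N ^ CARD('n))" for k
  proof -
    obtain m0 where m0: "m0 \<in> grid N \<and> (\<forall>i. int N dvd (k - m0) $ i)"
      "\<And>m. m \<in> grid N \<and> (\<forall>i. int N dvd (k - m) $ i) \<Longrightarrow> m = m0"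
      using ex1_grid_congruent [OF assms(1), of k] by blast
    then have "(\<Sum>m\<in>grid N. \<delta> k m) = (\<Sum>m\<in>grid N. if m = m0 then real (N ^ CARD('n)) else 0)"
      unfolding \<delta>_def by (intro sum.cong refl) metis
    then show ?thesis using m0(1) by (simp add: finite_grid)
  qed
  have sm: "(\<lambda>k. \<rho> * \<delta> k m * norm (c k)) summable_on UNIV" for m
  proof (rule summable_on_comparison_test)
    show "(\<lambda>k. \<rho> * real (N ^ CARD('n)) * norm (c k)) summable_on UNIV"
      by (intro summable_on_cmult_right c)
  qed (auto simp: \<delta>_def \<rho> mult_right_mono)
  have "norm (dft N (sample N (trig_series c)) m) \<le> (\<Sum>\<^sub>\<infinity>k. \<rho> * \<delta> k m * norm (c k))" for m
    by (rule norm_infsum_le [OF aliasing has_sum_infsum [OF sm]])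
       (simp add: norm_mult \<rho> \<delta>_def)
  then have "(\<Sum>m\<in>grid N. norm (dft N (sample N (trig_series c)) m)) \<le>
      (\<Sum>m\<in>grid N. \<Sum>\<^sub>\<infinity>k. \<rho> * \<delta> k m * norm (c k))"
    by (rule sum_mono)
  also have "\<dots> = (\<Sum>\<^sub>\<infinity>k. \<Sum>m\<in>grid N. \<rho> * \<delta> k m * norm (c k))"
    by (rule sym, rule infsumI, intro has_sum_sum finite_grid has_sum_infsum sm)
  also have "\<dots> = (\<Sum>\<^sub>\<infinity>k. \<rho> * real (N ^ CARD('n)) * norm (c k))"
    by (simp add: one_residue sum_distrib_left [symmetric] sum_distrib_right [symmetric] del: of_nat_power)
  also have "\<dots> = \<rho> * real (N ^ CARD('n)) * (\<Sum>\<^sub>\<infinity>k. norm (c k))"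
    by (intro infsum_cmult_right c)
  also have "\<rho> * real (N ^ CARD('n)) = real N powr (real CARD('n) / 2)"
    using assms(1) by (simp add: \<rho>_def powr_realpow [symmetric] powr_add [symmetric])
  finally show ?thesis .
qed

lemma lp_norm_grid_1: "lp_norm_grid 1 N h = (\<Sum>m\<in>grid N. norm (h m))"
  by (simp add: lp_norm_grid_def sum_nonneg)

lemma lp_norm_grid_2: "lp_norm_grid 2 N h = sqrt (\<Sum>m\<in>grid N. (norm (h m))\<^sup>2)"
  by (simp add: lp_norm_grid_def powr_half_sqrt sum_nonneg)

lemma heat_eq_trig_series:
  "heat t f = trig_series (\<lambda>k. of_real (exp (- (4 * pi\<^sup>2 * t) * (norm (int_vec k))\<^sup>2)) * fourier_coeff f k)"
  by (simp add: heat_def trig_series_def wave_def fun_eq_iff)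

theorem theorem4p13:
  fixes Cd t :: real
  assumes "Cd > 0"
    and "\<And>(N::nat) (F :: real^'n \<Rightarrow> complex). N \<ge> 2 \<Longrightarrow> periodic1 F \<Longrightarrow> C_k 2 F \<Longrightarrow>
      \<bar>1 / real N ^ CARD('n) * (\<Sum>x\<in>grid N. (norm (sample N F x))\<^sup>2)
        - integral (cbox 0 1) (\<lambda>u. (norm (F u))\<^sup>2)\<bar> \<le> Cd / real N * (C_k_norm 2 F)\<^sup>2"
    and "t > 0"
  shows "\<exists>C4>0. \<exists>C5>0. \<forall>(N::nat) (f :: real^'n \<Rightarrow> real).
    N \<ge> 2 \<longrightarrow> (\<exists>x. f x \<noteq> 0) \<longrightarrow> periodic1 f \<longrightarrow> C_k 2 f \<longrightarrow>
    (let H = heat t (\<lambda>x. complex_of_real (f x));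
         g = sample N H;
         A = 2 * (norm (integral (cbox 0 1) H) / L2_norm_cube H);
         B = C4 * (C_k_norm 2 f / L2_norm_cube H);
         C = C5 * (C_k_norm 2 f / L2_norm_cube H) * (1 / real N)
     in real N * (L2_norm_cube H)\<^sup>2 \<ge> 4 * Cd * (C_k_norm 2 H)\<^sup>2 \<longrightarrow>
        fourier_ratio N g \<le> A + B + C)"
proof -
  define w where "w k = exp (- (4 * pi\<^sup>2 * t) * (norm (int_vec k))\<^sup>2)" for k :: "int^'n"
  have tpos: "4 * pi\<^sup>2 * t > 0" using \<open>t > 0\<close> by simp
  have w_summable: "w summable_on UNIV"
    unfolding w_def by (rule gaussian_summable [OF tpos])
  define S where "S = (\<Sum>\<^sub>\<infinity>k. w k)"
  have "S > 0"
  proof -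
    have "w 0 = infsum w {0}" by simp
    also have "\<dots> \<le> S"
      unfolding S_def by (intro infsum_mono2 w_summable) (auto simp: w_def)
    finally show ?thesis by (rule less_le_trans [rotated]) (simp add: w_def)
  qed
  have main: "fourier_ratio N (sample N H) \<le> 2 * (norm (integral (cbox 0 1) H) / L2_norm_cube H) +
       2 * S * (C_k_norm 2 f / L2_norm_cube H) + 1 * (C_k_norm 2 f / L2_norm_cube H) * (1 / real N)"
    if "N \<ge> 2" "C_k 2 f" and H: "H = heat t (\<lambda>x. complex_of_real (f x))"
      and large: "real N * (L2_norm_cube H)\<^sup>2 \<ge> 4 * Cd * (C_k_norm 2 H)\<^sup>2"
    for N :: nat and f :: "real^'n \<Rightarrow> real" and H
  proof -
    define M where "M = C_k_norm 2 f"
    define L where "L = L2_norm_cube H"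
    define c where "c k = of_real (w k) * fourier_coeff (\<lambda>x. complex_of_real (f x)) k" for k
    have "N > 0" using \<open>N \<ge> 2\<close> by simp
    have a_le: "norm (fourier_coeff (\<lambda>x. complex_of_real (f x)) k) \<le> M" for k
      using C_k_imp_continuous [OF \<open>C_k 2 f\<close>] norm_le_C_k_norm [OF \<open>C_k 2 f\<close>]
      by (intro norm_fourier_coeff_le continuous_intros) (auto simp: M_def)
    have "M \<ge> 0" using a_le [of 0] norm_ge_zero order_trans by blast
    have H_series: "H = trig_series c"
      unfolding H heat_eq_trig_series c_def w_def ..
    have decay: "rapidly_decaying c"
      unfolding c_def w_def by (rule gaussian_rapidly_decaying [OF tpos a_le])
    have "(\<Sum>\<^sub>\<infinity>k. norm (c k)) \<le> (\<Sum>\<^sub>\<infinity>k. w k * M)"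
    proof (rule infsum_mono)
      show "norm (c k) \<le> w k * M" for k
        using a_le [of k] by (simp add: c_def norm_mult w_def)
    qed (use rapidly_decaying_abs_summable [OF decay] w_summable in \<open>auto intro: summable_on_cmult_left\<close>)
    also have "\<dots> = S * M"
      unfolding S_def by (intro infsum_cmult_left w_summable)
    finally have c_le: "(\<Sum>\<^sub>\<infinity>k. norm (c k)) \<le> S * M" .
    define Q where "Q = (\<Sum>x\<in>grid N. (norm (sample N H x))\<^sup>2)"
    have int_nonneg: "0 \<le> integral (cbox 0 1) (\<lambda>x. (norm (H x))\<^sup>2)"
      using continuous_trig_series [OF decay] unfolding H_series
      by (intro Henstock_Kurzweil_Integration.integral_nonneg integrable_continuous continuous_intros)
        (auto intro: continuous_on_subset)
    have L2: "integral (cbox 0 1) (\<lambda>x. (norm (H x))\<^sup>2) = L\<^sup>2"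
      unfolding L_def L2_norm_cube_def using int_nonneg by simp
    have "L \<ge> 0"
      unfolding L_def L2_norm_cube_def using int_nonneg by simp
    have riemann: "\<bar>1 / real N ^ CARD('n) * Q - L\<^sup>2\<bar> \<le> L\<^sup>2 / 4"
    proof -
      have "\<bar>1 / real N ^ CARD('n) * Q - L\<^sup>2\<bar> \<le> Cd / real N * (C_k_norm 2 H)\<^sup>2"
        unfolding Q_def L2 [symmetric]
        using assms(2) [OF \<open>N \<ge> 2\<close>, of H] periodic1_trig_series [of c] C_k_trig_series [OF decay]
        by (simp add: H_series)
      also have "\<dots> \<le> L\<^sup>2 / 4"
        using large \<open>N > 0\<close> by (simp add: L_def field_simps)
      finally show ?thesis .
    qed
    have "Q \<ge> 0" by (simp add: Q_def sum_nonneg)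
    have "fourier_ratio N (sample N H) \<le> 2 * S * (M / L)"
    proof (cases "L = 0")
      \<comment> \<open>the Riemann sum estimate makes the samples vanish, and both sides are 0 by convention\<close>
      case True
      then have "1 / real N ^ CARD('n) * Q \<le> 0" using riemann \<open>Q \<ge> 0\<close> by simp
      then have "Q = 0" using \<open>N > 0\<close> \<open>Q \<ge> 0\<close> by (simp add: field_simps)
      then have "\<forall>x\<in>grid N. sample N H x = 0"
        unfolding Q_def by (simp add: sum_nonneg_eq_0_iff finite_grid)
      then show ?thesis by (simp add: fourier_ratio_def True)
    next
      case False
      with \<open>L \<ge> 0\<close> have "L > 0" by simp
      \<comment> \<open>the common factor \<open>N\<^sup>d\<^sup>/\<^sup>2\<close> of the two norms cancels in the ratio\<close>
      define R where "R = real N powr (real CARD('n) / 2)"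
      have R: "R > 0" "R\<^sup>2 = real N ^ CARD('n)"
        using \<open>N > 0\<close> by (simp_all add: R_def powr_realpow [symmetric] powr_add [symmetric] power2_eq_square)
      have "(R * L / 2)\<^sup>2 \<le> Q"
      proof -
        have "L\<^sup>2 / 4 \<le> 1 / real N ^ CARD('n) * Q"
          using riemann \<open>L > 0\<close> zero_le_power2 [of L] by linarith
        then have "L\<^sup>2 / 4 * R\<^sup>2 \<le> Q"
          using R \<open>N > 0\<close> by (simp add: field_simps)
        then show ?thesis by (simp add: power_mult_distrib power_divide mult_ac)
      qed
      then have l2: "R * L / 2 \<le> sqrt Q"
        by (rule real_le_rsqrt)
      have "lp_norm_grid 1 N (dft N (sample N H)) \<le> R * (S * M)"
        unfolding lp_norm_grid_1 H_series
        using dft_trig_series_l1_le [OF \<open>N > 0\<close> rapidly_decaying_abs_summable [OF decay]] c_le R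
        by (elim order_trans) (simp add: R_def)
      moreover have "lp_norm_grid 2 N (dft N (sample N H)) = sqrt Q"
        by (simp add: lp_norm_grid_2 plancherel_grid [OF \<open>N > 0\<close>] Q_def)
      ultimately have "lp_norm_grid 1 N (dft N (sample N H)) / lp_norm_grid 2 N (dft N (sample N H))
          \<le> R * (S * M) / (R * L / 2)"
        using l2 R \<open>L > 0\<close> \<open>S > 0\<close> \<open>M \<ge> 0\<close> by (intro frac_le) auto
      also have "\<dots> = 2 * S * (M / L)"
        using R by (simp add: field_simps)
      finally show ?thesis
        using \<open>S > 0\<close> \<open>M \<ge> 0\<close> \<open>L > 0\<close> by (simp add: fourier_ratio_def)
    qed
    \<comment> \<open>what is left on the right-hand side is non-negative\<close>
    moreover have "0 \<le> 2 * (norm (integral (cbox 0 1) H) / L)" "0 \<le> 1 * (M / L) * (1 / real N)"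
      using \<open>L \<ge> 0\<close> \<open>M \<ge> 0\<close> by simp_all
    ultimately show ?thesis
      unfolding M_def L_def by linarith
  qed
  show ?thesis
    unfolding Let_def
    by (rule exI [of _ "2 * S"], rule conjI, simp add: \<open>S > 0\<close>, rule exI [of _ 1])
       (use main in auto)
qed

end
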